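(* Let $0<q<1$ and let $\varphi$ be an analytic function defined on the half-plane $H(\delta)=\{z\in\mathbb{C}:\Re(z)\ge-\delta\}$ for some $0<\delta<1$. Suppose that $\varphi$ is $\frac{2i\pi}{\mathrm{Log}(q)}$-periodic, and that there exist a continuous function $\varphi_1$ on $\mathbb{R}$ and a real number $r$ such that $$|\varphi(u+iw)|\le e^{r|u|}\varphi_1(w)\qquad\text{for all } u+iw\in H(\delta)\ (u,w\in\mathbb{R}).$$ Then, for all $s\in\mathbb{C}$ with $0<\Re(s)<\delta$, $$\int_0^\infty x^{s-1}\left(\sum_{n=0}^\infty(-1)^nq^{\frac{n(n+1)}{2}}\varphi(n)x^n\right)d_qx=\Gamma_q(s)\Gamma_q(1-s)\varphi(-s).$$
   Context: $\mathrm{Log}$ is the natural logarithm and $q^s=e^{s\,\mathrm{Log}\,q}$. $(a;q)_\infty=\prod_{k=0}^\infty(1-aq^k)$ for $a\in\mathbb{C}$. The $q$-gamma function is $\Gamma_q(s)=\frac{(q;q)_\infty}{(q^s;q)_\infty}(1-q)^{1-s}$. Jackson's $q$-integral is $\int_0^\infty g(x)\,d_qx=(1-q)\sum_{n=-\infty}^\infty g(q^n)q^n$. *)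

theory Defs
  imports "HOL-Complex_Analysis.Complex_Analysis"
begin

definition qpochhammer_inf :: "complex \<Rightarrow> real \<Rightarrow> complex" where
  "qpochhammer_inf a q = (\<Prod>k. 1 - a * of_real q ^ k)"

text \<open>For real \<open>b > 0\<close>, \<open>of_real b powr s\<close> is \<open>exp (s * of_real (ln b))\<close>.\<close>

definition q_Gamma :: "real \<Rightarrow> complex \<Rightarrow> complex" where
  "q_Gamma q s =
     qpochhammer_inf (of_real q) q / qpochhammer_inf (of_real q powr s) q *
     of_real (1 - q) powr (1 - s)"

text \<open>The bilateral series is an unordered sum over \<open>int\<close>, so integrability means absolute
  convergence; the value of the integral is only meaningful for integrable functions.\<close>

definition jackson_integrable :: "real \<Rightarrow> (real \<Rightarrow> complex) \<Rightarrow> bool" where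
  "jackson_integrable q g \<longleftrightarrow>
     (\<lambda>n::int. g (q powi n) * of_real (q powi n)) summable_on UNIV"

definition jackson_integral :: "real \<Rightarrow> (real \<Rightarrow> complex) \<Rightarrow> complex" where
  "jackson_integral q g =
     of_real (1 - q) * (\<Sum>\<^sub>\<infinity>n::int. g (q powi n) * of_real (q powi n))"

definition half_plane :: "real \<Rightarrow> complex set" where
  "half_plane \<delta> = {z. Re z \<ge> - \<delta>}"

end

theory Submission
  imports Defs
begin

text \<open>
  Periodicity makes \<open>\<phi>\<close> a function of \<open>w = q\<^sup>z\<close> on a punctured disc, and the exponential bound
  makes its singularity at \<open>w = 0\<close> at worst a pole. Hence \<open>\<phi>(z) = \<Sum> c\<^sub>k q\<^bsup>(k - N)z\<^esup>\<close>, absolutely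
  convergent for \<open>Re z > -\<delta>\<close> (\<open>periodic_laurent_expansion\<close>). Both sides of the claim are linear
  in \<open>\<phi>\<close>. For a single exponential \<open>\<phi>(z) = q\<^bsup>mz\<^esup>\<close> the power series in the integrand is
  \<open>F(q\<^sup>m x)\<close>, where \<open>F(x) = \<Sum> (-1)\<^sup>n q\<^bsup>n(n+1)/2\<^esup> x\<^sup>n\<close> is the partial theta function, and the
  shift \<open>x \<mapsto> q\<^sup>m x\<close> permutes the points \<open>q\<^sup>j\<close> that the Jackson integral sees. So it
  produces the factor \<open>q\<^bsup>-ms\<^esup> = \<phi>(-s)\<close>, and the case \<open>\<phi> = 1\<close> remains: for \<open>q < |z| < 1\<close>,
  \[ \sum_{j \in \mathbb{Z}} z^j F(q^j) = \frac{(q;q)_\infty^2}{(z;q)_\infty (q/z;q)_\infty}. \]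

  This identity is \<open>partial_theta_bilateral_sum\<close>. Its right-hand side is expanded by Euler's
  formula \<open>1/(z;q)\<^sub>\<infinity> = \<Sum> z\<^sup>n/(q;q)\<^sub>n\<close>, applied at \<open>z\<close> and at \<open>q/z\<close>. The coefficient
  of \<open>z\<^sup>j\<close> in the product of the two series is
  \<open>u\<^sub>j = \<Sum>\<^sub>m q\<^sup>m/((q;q)\<^sub>m (q;q)\<^bsub>m+j\<^esub>)\<close>. A telescoping sum gives
  \<open>u\<^sub>j + q\<^bsup>j+1\<^esup> u\<^bsub>j+1\<^esub> = 1/(q;q)\<^sub>\<infinity>\<^sup>2\<close>, which up to the factor \<open>(q;q)\<^sub>\<infinity>\<^sup>2\<close> is
  the functional equation \<open>F(x) = 1 - qx F(qx)\<close> at \<open>x = q\<^sup>j\<close>. Only one solution of this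
  recurrence is bounded as \<open>j \<rightarrow> \<infinity>\<close>, so \<open>F(q\<^sup>j) = (q;q)\<^sub>\<infinity>\<^sup>2 u\<^sub>j\<close>. In particular the
  absolute convergence of the bilateral series comes for free from that of the two Euler series.
\<close>

section \<open>Products of absolutely convergent series\<close>

lemma summable_on_mult_Times:
  fixes f :: "'a \<Rightarrow> complex" and g :: "'b \<Rightarrow> complex"
  assumes f: "f summable_on A" and g: "g summable_on B"
  shows "(\<lambda>p. f (fst p) * g (snd p)) summable_on A \<times> B"
proof -
  have fa: "(\<lambda>x. norm (f x)) summable_on A" and ga: "(\<lambda>y. norm (g y)) summable_on B"
    using f g by (simp_all add: summable_on_iff_abs_summable_on_complex)
  have "(\<lambda>p. norm (f (fst p) * g (snd p))) summable_on A \<times> B"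
    unfolding Infinite_Sum.abs_summable_on_Sigma_iff using fa ga
    by (auto simp: norm_mult infsum_cmult_right' abs_mult
          intro!: summable_on_cmult_right summable_on_cmult_left)
  then show ?thesis by (rule abs_summable_summable)
qed

text \<open>
  The product of the two sums is a sum over the grid \<open>\<int> \<times> \<nat>\<close>, and
  \<open>(j, k) \<mapsto> (j + \<sigma> k, k)\<close> permutes that grid. With \<open>\<sigma> k = k\<close> this collects the
  coefficients of a product of a series in \<open>z\<close> and one in \<open>1/z\<close>; with \<open>\<sigma> k = k - N\<close> it
  carries out the shift of the Jackson integral for each term of the Laurent series of \<open>\<phi>\<close>.
\<close>
lemma has_sum_mult_shear:
  fixes f :: "int \<Rightarrow> complex" and g :: "nat \<Rightarrow> complex" and \<sigma> :: "nat \<Rightarrow> int"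
  assumes f: "f summable_on UNIV" and g: "g summable_on UNIV"
  shows "((\<lambda>j. \<Sum>\<^sub>\<infinity>k. f (j + \<sigma> k) * g k) has_sum (infsum f UNIV * infsum g UNIV)) UNIV"
    and "\<And>j. (\<lambda>k. f (j + \<sigma> k) * g k) summable_on UNIV"
proof -
  have "(\<lambda>p. f (fst p) * g (snd p)) summable_on UNIV \<times> UNIV"
    by (rule summable_on_mult_Times[OF f g])
  then obtain S where S: "((\<lambda>p. f (fst p) * g (snd p)) has_sum S) (UNIV \<times> UNIV)"
    by (auto simp: summable_on_def)
  have "((\<lambda>i. f i * infsum g UNIV) has_sum S) UNIV"
    by (rule has_sum_SigmaD[OF S]) (auto intro!: has_sum_cmult_right has_sum_infsum g)
  moreover have "((\<lambda>i. f i * infsum g UNIV) has_sum (infsum f UNIV * infsum g UNIV)) UNIV"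
    by (intro has_sum_cmult_left has_sum_infsum f)
  ultimately have S_eq: "S = infsum f UNIV * infsum g UNIV"
    by (rule has_sum_unique)
  have T: "((\<lambda>p. f (fst p + \<sigma> (snd p)) * g (snd p)) has_sum S) (UNIV \<times> UNIV)"
    using S
    by (subst has_sum_reindex_bij_witness[where j = "\<lambda>p. (fst p + \<sigma> (snd p), snd p)"
          and i = "\<lambda>p. (fst p - \<sigma> (snd p), snd p)" and T = "UNIV \<times> UNIV"
          and h = "\<lambda>p. f (fst p) * g (snd p)" and s' = S]) auto
  show row: "(\<lambda>k. f (j + \<sigma> k) * g k) summable_on UNIV" for j
    using summable_on_SigmaD1[of "\<lambda>j k. f (j + \<sigma> k) * g k" UNIV "\<lambda>_. UNIV" j] T
    by (auto simp: summable_on_def case_prod_unfold)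
  show "((\<lambda>j. \<Sum>\<^sub>\<infinity>k. f (j + \<sigma> k) * g k) has_sum (infsum f UNIV * infsum g UNIV)) UNIV"
    unfolding S_eq[symmetric]
    by (rule has_sum_SigmaD[OF T]) (auto intro!: has_sum_infsum row)
qed

lemma infsum_nat_eq_suminf:
  fixes f :: "nat \<Rightarrow> complex"
  assumes "f summable_on UNIV"
  shows "infsum f UNIV = suminf f"
  using has_sum_imp_sums[OF has_sum_infsum[OF assms]] by (simp add: sums_iff)

lemma has_sum_int_of_has_sum_nat:
  fixes f :: "int \<Rightarrow> complex"
  assumes "\<And>n. n < 0 \<Longrightarrow> f n = 0" and "((\<lambda>n. f (int n)) has_sum S) UNIV"
  shows "(f has_sum S) UNIV"
proof -
  have "(f has_sum S) (range int)"
    using assms(2) by (subst has_sum_reindex) (auto simp: o_def)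
  moreover have "(f has_sum S) (range int) \<longleftrightarrow> (f has_sum S) UNIV"
  proof (rule has_sum_cong_neutral)
    fix n assume "n \<in> UNIV - range int"
    then have "n < 0" by (metis DiffD2 nonneg_int_cases not_le rangeI)
    then show "f n = 0" by (rule assms(1))
  qed auto
  ultimately show ?thesis by simp
qed

section \<open>The partial theta series\<close>

lemma summable_qsquare_power:
  fixes q y :: real
  assumes "0 < q" "q < 1" "0 \<le> y"
  shows "summable (\<lambda>n. q ^ (n * (n + 1) div 2) * y ^ n)"
proof -
  have step: "q ^ (Suc n * (Suc n + 1) div 2) * y ^ Suc n
      = (q ^ Suc n * y) * (q ^ (n * (n + 1) div 2) * y ^ n)" for n
  proof -
    have "Suc n * (Suc n + 1) div 2 = Suc n + n * (n + 1) div 2"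
      by (simp add: algebra_simps)
    then show ?thesis by (simp add: power_add)
  qed
  have "(\<lambda>n. q ^ Suc n * y) \<longlonglongrightarrow> 0"
    using assms by (intro tendsto_mult_left_zero LIMSEQ_Suc LIMSEQ_realpow_zero) auto
  then have "eventually (\<lambda>n. q ^ Suc n * y < 1/2) sequentially"
    by (rule order_tendstoD) simp
  then obtain N where N: "\<And>n. n \<ge> N \<Longrightarrow> q ^ Suc n * y < 1/2"
    by (auto simp: eventually_sequentially)
  show ?thesis
  proof (rule summable_ratio_test[where c = "1/2" and N = N])
    fix n assume "n \<ge> N"
    then have "q ^ Suc n * y \<le> 1/2" using N by fastforce
    then have "(q ^ Suc n * y) * (q ^ (n * (n + 1) div 2) * y ^ n)
        \<le> 1/2 * (q ^ (n * (n + 1) div 2) * y ^ n)"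
      using assms by (intro mult_right_mono) auto
    then show "norm (q ^ (Suc n * (Suc n + 1) div 2) * y ^ Suc n)
        \<le> 1/2 * norm (q ^ (n * (n + 1) div 2) * y ^ n)"
      unfolding step using assms by (simp add: abs_mult)
  qed simp
qed

definition partial_theta :: "real \<Rightarrow> complex \<Rightarrow> complex" where
  "partial_theta q x = (\<Sum>n. (- 1) ^ n * of_real q ^ (n * (n + 1) div 2) * x ^ n)"

section \<open>Euler's expansion of the reciprocal \<open>q\<close>-Pochhammer symbol\<close>

text \<open>
  The convention \<open>1/(q;q)\<^sub>n = 0\<close> for \<open>n < 0\<close> makes the recurrence \<open>recip_qfact_rec\<close> valid
  for all integers \<open>n\<close> (at \<open>n = 0\<close> both sides vanish), so that series over \<open>n \<ge> 0\<close> can be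
  treated as series over all integers.
\<close>
definition recip_qfact :: "real \<Rightarrow> int \<Rightarrow> complex" where
  "recip_qfact q n =
     (if n < 0 then 0 else 1 / (\<Prod>k<nat n. 1 - of_real q * of_real q ^ k))"

context
  fixes q :: real
  assumes q_pos: "0 < q" and q_less_1: "q < 1"
begin

abbreviation (input) Q :: complex where "Q \<equiv> of_real q"

lemma Q_nonzero: "Q \<noteq> 0" and norm_Q: "norm Q = q"
  using q_pos by auto

lemma convergent_prod_qpochhammer: "convergent_prod (\<lambda>k. 1 - a * Q ^ k)"
proof -
  have "summable (\<lambda>k. norm (1 - a * Q ^ k - 1))"
    using q_pos q_less_1 by (simp add: norm_mult norm_power summable_geometric summable_mult)
  then show ?thesis
    by (intro abs_convergent_prod_imp_convergent_prod summable_imp_abs_convergent_prod)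
qed

lemma qpochhammer_tendsto: "(\<lambda>n. \<Prod>k<n. 1 - a * Q ^ k) \<longlonglongrightarrow> qpochhammer_inf a q"
  unfolding qpochhammer_inf_def
  by (intro has_prod_imp_tendsto' convergent_prod_has_prod convergent_prod_qpochhammer)

lemma qpochhammer_factor_nonzero: "norm a < 1 \<Longrightarrow> 1 - a * Q ^ k \<noteq> 0"
proof
  assume a: "norm a < 1" and "1 - a * Q ^ k = 0"
  then have "norm a * q ^ k = 1"
    using q_pos by (metis eq_iff_diff_eq_0 norm_Q norm_mult norm_one norm_power)
  moreover have "norm a * q ^ k \<le> norm a * 1"
    using q_pos q_less_1 by (intro mult_left_mono power_le_one) auto
  ultimately show False using a by simp
qed

lemma qpochhammer_nonzero: "norm a < 1 \<Longrightarrow> qpochhammer_inf a q \<noteq> 0"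
  unfolding qpochhammer_inf_def
  by (intro prodinf_nonzero convergent_prod_qpochhammer qpochhammer_factor_nonzero)

lemma recip_qfact_neg [simp]: "n < 0 \<Longrightarrow> recip_qfact q n = 0"
  by (simp add: recip_qfact_def)

lemma recip_qfact_0 [simp]: "recip_qfact q 0 = 1"
  by (simp add: recip_qfact_def)

lemma recip_qfact_rec: "(1 - Q powi n) * recip_qfact q n = recip_qfact q (n - 1)"
proof (cases "n \<le> 0")
  case True
  then show ?thesis by (cases "n = 0") auto
next
  case False
  then obtain m where m: "n = int (Suc m)" by (metis not_le pos_int_cases Suc_pred)
  have "1 - Q * Q ^ m \<noteq> 0"
    by (rule qpochhammer_factor_nonzero) (use q_pos q_less_1 in auto)
  moreover have "nat (1 + int m) = Suc m" by simp
  ultimately show ?thesis by (simp add: m recip_qfact_def power_int_add Q_nonzero)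
qed

lemma recip_qfact_tendsto: 
  "(\<lambda>n. recip_qfact q (int n + j)) \<longlonglongrightarrow> 1 / qpochhammer_inf Q q"
proof -
  have "qpochhammer_inf Q q \<noteq> 0"
    by (rule qpochhammer_nonzero) (use q_pos q_less_1 in auto)
  then have *: "(\<lambda>n. 1 / (\<Prod>k<n. 1 - Q * Q ^ k)) \<longlonglongrightarrow> 1 / qpochhammer_inf Q q"
    by (intro tendsto_intros qpochhammer_tendsto)
  have "filterlim (\<lambda>n. nat (int n + j)) at_top sequentially"
    unfolding filterlim_at_top
  proof
    fix Z show "eventually (\<lambda>n. Z \<le> nat (int n + j)) sequentially"
      unfolding eventually_sequentially by (rule exI[of _ "Z + nat (- j)"]) auto
  qed
  from filterlim_compose[OF * this]
  have "(\<lambda>n. 1 / (\<Prod>k<nat (int n + j). 1 - Q * Q ^ k)) \<longlonglongrightarrow> 1 / qpochhammer_inf Q q" .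
  moreover have "eventually (\<lambda>n. 1 / (\<Prod>k<nat (int n + j). 1 - Q * Q ^ k)
      = recip_qfact q (int n + j)) sequentially"
    unfolding eventually_sequentially
    by (rule exI[of _ "nat (- j)"]) (auto simp: recip_qfact_def)
  ultimately show ?thesis by (rule Lim_transform_eventually)
qed

lemma recip_qfact_bounded: "\<exists>B\<ge>0. \<forall>n. norm (recip_qfact q n) \<le> B"
proof -
  have "Bseq (\<lambda>n. recip_qfact q (int n + 0))"
    by (intro convergent_imp_Bseq convergentI[OF recip_qfact_tendsto])
  then obtain B where B: "B > 0" "\<And>n. norm (recip_qfact q (int n)) \<le> B"
    by (auto simp: Bseq_def)
  have "norm (recip_qfact q n) \<le> B" for n
    using B by (cases n) auto
  then show ?thesis using B(1) by (intro exI[of _ B]) auto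
qed

lemma summable_recip_qfact:
  assumes "norm z < 1"
  shows "summable (\<lambda>n. norm (z ^ n * recip_qfact q (int n + j)))"
proof -
  obtain B where B: "B \<ge> 0" "\<And>n. norm (recip_qfact q n) \<le> B"
    using recip_qfact_bounded by blast
  have "summable (\<lambda>n. norm z ^ n * B)"
    using assms by (intro summable_mult2 summable_geometric) auto
  then show ?thesis
    by (rule summable_comparison_test')
       (auto simp: norm_mult norm_power intro!: mult_left_mono B)
qed

text \<open>
  The recurrence of the coefficients turns into \<open>E(qz) = (1 - z) E(z)\<close> for the sum \<open>E\<close>.
  Iterating gives \<open>E(q\<^sup>N z) = (z;q)\<^sub>N E(z)\<close>, and the left-hand side tends to \<open>E(0) = 1\<close>.
\<close>
lemma euler_recip_qpochhammer:
  assumes z: "norm z < 1"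
  shows "((\<lambda>n. z ^ n * recip_qfact q (int n)) has_sum (1 / qpochhammer_inf z q)) UNIV"
proof -
  define E where "E = (\<lambda>w. \<Sum>n. w ^ n * recip_qfact q (int n))"
  have sm: "summable (\<lambda>n. w ^ n * recip_qfact q (int n))" if "norm w < 1" for w
    using summable_recip_qfact[OF that, of 0] by (auto dest: summable_norm_cancel)
  have step: "E (Q * w) = (1 - w) * E w" if w: "norm w < 1" for w
  proof -
    have qw: "norm (Q * w) < 1"
    proof -
      have "q * norm w \<le> 1 * norm w" using q_less_1 by (intro mult_right_mono) auto
      then show ?thesis using w q_pos by (simp add: norm_mult)
    qed
    have "E w - E (Q * w) = (\<Sum>n. w ^ n * recip_qfact q (int n - 1))"
      unfolding E_def suminf_diff[OF sm[OF w] sm[OF qw]]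
      by (rule suminf_cong)
         (simp add: recip_qfact_rec[symmetric] power_mult_distrib algebra_simps)
    also have "\<dots> = (\<Sum>n. w ^ Suc n * recip_qfact q (int n))"
    proof -
      have "summable (\<lambda>n. w ^ n * recip_qfact q (int n - 1))"
        using summable_recip_qfact[OF w, of "- 1"] by (auto dest: summable_norm_cancel)
      from suminf_split_head[OF this] show ?thesis by simp
    qed
    also have "\<dots> = w * E w"
      unfolding E_def by (subst suminf_mult[symmetric, OF sm[OF w]]) (simp add: mult.assoc)
    finally show ?thesis by (simp add: algebra_simps)
  qed
  have iter: "E (Q ^ N * z) = (\<Prod>k<N. 1 - z * Q ^ k) * E z" for N
  proof (induction N)
    case (Suc N)
    have "norm (Q ^ N * z) \<le> 1 * norm z"
      unfolding norm_mult norm_power norm_Q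
      using q_pos q_less_1 by (intro mult_right_mono power_le_one) auto
    then have "norm (Q ^ N * z) < 1" using z by simp
    from step[OF this] Suc show ?case by (simp add: mult_ac)
  qed simp
  have "isCont E 0"
    unfolding E_def
    by (subst mult.commute, rule isCont_powser[where K = "1/2"]) 
       (use sm[of "1/2"] in \<open>auto simp: mult.commute\<close>)
  moreover have "(\<lambda>N. Q ^ N * z) \<longlonglongrightarrow> 0"
    using q_pos q_less_1 by (intro tendsto_mult_left_zero LIMSEQ_power_zero) auto
  ultimately have "(\<lambda>N. E (Q ^ N * z)) \<longlonglongrightarrow> E 0"
    by (rule isCont_tendsto_compose)
  moreover have "E 0 = 1"
    unfolding E_def by (subst suminf_finite[of "{0}"]) auto
  moreover have "(\<lambda>N. E (Q ^ N * z)) \<longlonglongrightarrow> qpochhammer_inf z q * E z"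
    unfolding iter by (intro tendsto_intros qpochhammer_tendsto)
  ultimately have "qpochhammer_inf z q * E z = 1"
    using LIMSEQ_unique by metis
  then have "E z = 1 / qpochhammer_inf z q"
    using qpochhammer_nonzero[OF z] by (simp add: field_simps)
  moreover have "(\<lambda>n. z ^ n * recip_qfact q (int n)) sums E z"
    unfolding E_def using sm[OF z] by (rule summable_sums)
  ultimately show ?thesis
    using summable_recip_qfact[OF z, of 0] norm_summable_imp_has_sum by simp
qed

section \<open>The bilateral generating function of the partial theta function\<close>

text \<open>
  The coefficient of \<open>z\<^sup>j\<close> in \<open>1 / ((z;q)\<^sub>\<infinity> (q/z;q)\<^sub>\<infinity>)\<close> on the annulus \<open>q < |z| < 1\<close>.
\<close>
definition laurent_coeff :: "int \<Rightarrow> complex" where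
  "laurent_coeff j = (\<Sum>m. Q ^ m * (recip_qfact q (int m) * recip_qfact q (int m + j)))"

lemma summable_laurent_coeff:
  "summable (\<lambda>m. Q ^ m * (recip_qfact q (int m) * recip_qfact q (int m + j)))"
  and laurent_coeff_bounded: "\<exists>C. \<forall>j. norm (laurent_coeff j) \<le> C"
proof -
  obtain B where B: "B \<ge> 0" "\<And>n. norm (recip_qfact q n) \<le> B"
    using recip_qfact_bounded by blast
  have sg: "summable (\<lambda>n. q ^ n * (B * B))"
    using q_pos q_less_1 by (intro summable_mult2 summable_geometric) auto
  have bd: "norm (Q ^ m * (recip_qfact q (int m) * recip_qfact q (int m + j))) \<le> q ^ m * (B * B)" 
    for m j
    unfolding norm_mult norm_power norm_Q
    using q_pos B by (intro mult_left_mono mult_mono) auto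
  show "summable (\<lambda>m. Q ^ m * (recip_qfact q (int m) * recip_qfact q (int m + j)))"
    by (rule summable_comparison_test'[OF sg bd])
  have "norm (laurent_coeff j) \<le> (\<Sum>n. q ^ n * (B * B))" for j
    unfolding laurent_coeff_def by (rule norm_suminf_le[OF bd sg])
  then show "\<exists>C. \<forall>j. norm (laurent_coeff j) \<le> C" by blast
qed

text \<open>
  With \<open>e\<^sub>n = 1/(q;q)\<^sub>n\<close>, the recurrence of \<open>e\<close> eliminates the powers of \<open>q\<close>: the \<open>m\<close>-th terms
  of the two series add up to
  \<open>(e\<^sub>m - e\<^bsub>m-1\<^esub>) e\<^bsub>m+j\<^esub> + e\<^sub>m (e\<^bsub>m+j+1\<^esub> - e\<^bsub>m+j\<^esub>) = e\<^sub>m e\<^bsub>m+j+1\<^esub> - e\<^bsub>m-1\<^esub> e\<^bsub>m+j\<^esub>\<close>,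
  which telescopes.
\<close>
lemma laurent_coeff_rec:
  "laurent_coeff j + Q powi (j + 1) * laurent_coeff (j + 1) = 1 / qpochhammer_inf Q q ^ 2"
proof -
  let ?e = "recip_qfact q"
  define T where "T = (\<lambda>m. ?e (int m - 1) * ?e (int m + j))"
  have "T \<longlonglongrightarrow> (1 / qpochhammer_inf Q q) * (1 / qpochhammer_inf Q q)"
    unfolding T_def
    using tendsto_mult[OF recip_qfact_tendsto[of "- 1"] recip_qfact_tendsto[of j]] by simp
  then have "(\<lambda>m. T (Suc m) - T m) sums ((1 / qpochhammer_inf Q q) * (1 / qpochhammer_inf Q q) - T 0)"
    by (rule telescope_sums)
  moreover have "T (Suc m) - T m = Q ^ m * (?e (int m) * ?e (int m + j))
      + Q powi (j + 1) * (Q ^ m * (?e (int m) * ?e (int m + (j + 1))))" for m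
  proof -
    have 1: "Q ^ m * ?e (int m) = ?e (int m) - ?e (int m - 1)"
      using recip_qfact_rec[of "int m"] by (simp add: algebra_simps)
    have 2: "Q powi (j + 1) * Q ^ m * ?e (int m + (j + 1)) = ?e (int m + (j + 1)) - ?e (int m + j)"
    proof -
      have "Q powi (j + 1) * Q ^ m = Q powi (int m + (j + 1))"
        using Q_nonzero by (simp add: power_int_add mult_ac)
      then show ?thesis
        using recip_qfact_rec[of "int m + (j + 1)"] by (simp add: algebra_simps)
    qed
    have "Q ^ m * (?e (int m) * ?e (int m + j))
      + Q powi (j + 1) * (Q ^ m * (?e (int m) * ?e (int m + (j + 1))))
      = (Q ^ m * ?e (int m)) * ?e (int m + j) 
        + ?e (int m) * (Q powi (j + 1) * Q ^ m * ?e (int m + (j + 1)))"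
      by (simp add: mult_ac)
    also have "\<dots> = T (Suc m) - T m"
      unfolding 1 2 T_def by (simp add: algebra_simps)
    finally show ?thesis by simp
  qed
  moreover have "(\<lambda>m. Q ^ m * (?e (int m) * ?e (int m + j))
      + Q powi (j + 1) * (Q ^ m * (?e (int m) * ?e (int m + (j + 1)))))
      sums (laurent_coeff j + Q powi (j + 1) * laurent_coeff (j + 1))"
    unfolding laurent_coeff_def 
    by (intro sums_add sums_mult summable_sums summable_laurent_coeff)
  ultimately show ?thesis
    by (simp add: sums_iff T_def power2_eq_square)
qed

lemma summable_partial_theta:
  "summable (\<lambda>n. norm ((- 1) ^ n * Q ^ (n * (n + 1) div 2) * x ^ n))"
  using summable_qsquare_power[OF q_pos q_less_1, of "norm x"] q_pos
  by (simp add: norm_mult norm_power)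

lemma partial_theta_rec: "partial_theta q x = 1 - Q * x * partial_theta q (Q * x)"
proof -
  let ?t = "\<lambda>x n. (- 1) ^ n * Q ^ (n * (n + 1) div 2) * x ^ n"
  have sm: "summable (?t x)" for x
    using summable_partial_theta by (rule summable_norm_cancel)
  have "?t x (Suc n) = - (Q * x) * ?t (Q * x) n" for n
  proof -
    have "Suc n * (Suc n + 1) div 2 = Suc n + n * (n + 1) div 2"
      by (simp add: algebra_simps)
    then show ?thesis by (simp add: power_add power_mult_distrib)
  qed
  then have "(\<Sum>n. - (Q * x) * ?t (Q * x) n) = (\<Sum>n. ?t x (Suc n))"
    by (intro suminf_cong) (rule sym)
  also have "\<dots> = partial_theta q x - 1"
    using suminf_split_head[OF sm[of x]] by (simp add: partial_theta_def)
  finally have "partial_theta q x - 1 = (\<Sum>n. - (Q * x) * ?t (Q * x) n)" ..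
  also have "\<dots> = - (Q * x) * partial_theta q (Q * x)"
    unfolding partial_theta_def by (rule suminf_mult[OF sm])
  finally show ?thesis by (simp add: algebra_simps)
qed

lemma partial_theta_bounded: "\<exists>C. \<forall>x. norm x \<le> 1 \<longrightarrow> norm (partial_theta q x) \<le> C"
proof -
  have "norm (partial_theta q x) \<le> (\<Sum>n. q ^ (n * (n + 1) div 2) * 1 ^ n)" if "norm x \<le> 1" for x
    unfolding partial_theta_def
  proof (rule norm_suminf_le)
    show "norm ((- 1) ^ n * Q ^ (n * (n + 1) div 2) * x ^ n) \<le> q ^ (n * (n + 1) div 2) * 1 ^ n" for n
      unfolding norm_mult norm_power norm_Q using that q_pos
      by (intro mult_mono power_mono) auto
  qed (use summable_qsquare_power[OF q_pos q_less_1, of 1] in simp)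
  then show ?thesis by blast
qed

text \<open>
  For \<open>j \<ge> 0\<close> each step of the recurrence gains a factor of at most \<open>q\<close>, so \<open>|d\<^sub>j| \<le> q\<^sup>n C\<close> for
  every \<open>n\<close>. The values at negative \<open>j\<close> are determined by \<open>d\<^sub>0\<close>.
\<close>
lemma bounded_homogeneous_solution_zero:
  fixes d :: "int \<Rightarrow> complex"
  assumes rec: "\<And>j. d j = - (Q powi (j + 1)) * d (j + 1)"
    and bd: "\<And>j. j \<ge> 0 \<Longrightarrow> norm (d j) \<le> C"
  shows "d j = 0"
proof -
  have le: "norm (d j) \<le> q ^ n * C" if "j \<ge> 0" for j n
    using that
  proof (induction n arbitrary: j)
    case (Suc n)
    have "q powi (j + 1) \<le> q"
      using Suc.prems q_pos q_less_1 power_int_decreasing[of 1 "j + 1" q] by simp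
    moreover have "norm (d (j + 1)) \<le> q ^ n * C" using Suc by simp
    ultimately have "q powi (j + 1) * norm (d (j + 1)) \<le> q * (q ^ n * C)"
      using q_pos by (intro mult_mono) auto
    then show ?case
      using q_pos by (subst rec) (simp add: norm_mult norm_power_int)
  qed (use bd in simp)
  have nonneg: "d j = 0" if "j \<ge> 0" for j
  proof -
    have "(\<lambda>n. q ^ n * C) \<longlonglongrightarrow> 0"
      using q_pos q_less_1 by (intro tendsto_mult_left_zero LIMSEQ_realpow_zero) auto
    then have "norm (d j) \<le> 0"
      by (rule LIMSEQ_le_const) (use le[OF that] in auto)
    then show ?thesis by simp
  qed
  have "d (- int n) = 0" for n
  proof (induction n)
    case (Suc n)
    then show ?case using rec[of "- int (Suc n)"] by simp
  qed (use nonneg in simp)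
  then show ?thesis using nonneg by (metis int_cases2 of_nat_0_le_iff)
qed

lemma partial_theta_eq_laurent_coeff:
  "partial_theta q (Q powi j) = qpochhammer_inf Q q ^ 2 * laurent_coeff j"
proof -
  define d where "d = (\<lambda>j. partial_theta q (Q powi j) - qpochhammer_inf Q q ^ 2 * laurent_coeff j)"
  have nz: "qpochhammer_inf Q q ^ 2 \<noteq> 0"
    using q_pos q_less_1 qpochhammer_nonzero[of Q] by simp
  obtain C1 where C1: "\<And>x. norm x \<le> 1 \<Longrightarrow> norm (partial_theta q x) \<le> C1"
    using partial_theta_bounded by blast
  obtain C2 where C2: "\<And>j. norm (laurent_coeff j) \<le> C2"
    using laurent_coeff_bounded by blast
  have "d j = 0"
  proof (rule bounded_homogeneous_solution_zero)
    fix j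
    have "laurent_coeff j = 1 / qpochhammer_inf Q q ^ 2 - Q powi (j + 1) * laurent_coeff (j + 1)"
      using laurent_coeff_rec[of j] by (simp add: algebra_simps)
    then have "qpochhammer_inf Q q ^ 2 * laurent_coeff j
        = 1 - Q powi (j + 1) * (qpochhammer_inf Q q ^ 2 * laurent_coeff (j + 1))"
      using nz by (simp add: right_diff_distrib mult_ac)
    moreover have "partial_theta q (Q powi j) = 1 - Q powi (j + 1) * partial_theta q (Q powi (j + 1))"
      using partial_theta_rec[of "Q powi j"] Q_nonzero by (simp add: power_int_add mult_ac)
    ultimately show "d j = - (Q powi (j + 1)) * d (j + 1)"
      unfolding d_def by (simp add: algebra_simps)
  next
    fix j :: int assume "j \<ge> 0"
    then have "norm (Q powi j) \<le> 1"
      using q_pos q_less_1 by (auto simp: norm_power power_int_def intro!: power_le_one)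
    then show "norm (d j) \<le> C1 + norm (qpochhammer_inf Q q ^ 2) * C2"
      unfolding d_def
      by (intro order.trans[OF norm_triangle_ineq4] add_mono C1)
         (auto simp: norm_mult intro!: mult_left_mono C2)
  qed
  then show ?thesis by (simp add: d_def)
qed

lemma partial_theta_bilateral_sum:
  assumes z: "q < norm z" "norm z < 1"
  shows "((\<lambda>j. z powi j * partial_theta q (Q powi j)) has_sum
    (qpochhammer_inf Q q ^ 2 / (qpochhammer_inf z q * qpochhammer_inf (Q / z) q))) UNIV"
proof -
  let ?e = "recip_qfact q"
  have z0: "z \<noteq> 0" using z q_pos by auto
  have qz: "norm (Q / z) < 1" using z q_pos by (simp add: norm_divide divide_simps)
  define f where "f = (\<lambda>n. z powi n * ?e n)"
  define g where "g = (\<lambda>m::nat. (Q / z) ^ m * ?e (int m))"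
  have f: "(f has_sum (1 / qpochhammer_inf z q)) UNIV"
    by (rule has_sum_int_of_has_sum_nat) (use euler_recip_qpochhammer[OF z(2)] in \<open>auto simp: f_def\<close>)
  have g: "(g has_sum (1 / qpochhammer_inf (Q / z) q)) UNIV"
    unfolding g_def by (rule euler_recip_qpochhammer[OF qz])
  note shear = has_sum_mult_shear[of f g, where \<sigma> = int]
  have "(\<Sum>\<^sub>\<infinity>k. f (j + int k) * g k) = z powi j * laurent_coeff j" for j
  proof -
    have "f (j + int k) * g k = z powi j * (Q ^ k * (?e (int k) * ?e (int k + j)))" for k
      unfolding f_def g_def using z0 by (simp add: power_int_add power_divide add.commute)
    moreover have "(\<Sum>\<^sub>\<infinity>k. f (j + int k) * g k) = (\<Sum>k. f (j + int k) * g k)"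
      by (rule infsum_nat_eq_suminf) (use shear(2)[of j] f g in \<open>auto simp: summable_on_def\<close>)
    ultimately show ?thesis
      unfolding laurent_coeff_def by (simp add: suminf_mult summable_laurent_coeff)
  qed
  then have "((\<lambda>j. z powi j * laurent_coeff j) has_sum
      (1 / qpochhammer_inf z q * (1 / qpochhammer_inf (Q / z) q))) UNIV"
    using shear(1) f g by (auto simp: summable_on_def infsumI)
  from has_sum_cmult_right[OF this, of "qpochhammer_inf Q q ^ 2"]
  show ?thesis by (simp add: partial_theta_eq_laurent_coeff mult_ac)
qed

section \<open>Superposition of partial theta functions\<close>

text \<open>
  Here \<open>\<phi>(n)\<close> is the Laurent series at the point \<open>q\<^sup>n\<close>. The double series over \<open>n\<close> and \<open>k\<close> is
  dominated by a product of two convergent series, because the only factor that couples the two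
  indices, \<open>q\<^bsup>kn\<^esup>\<close>, is at most \<open>1\<close>; the pole, being of finite order \<open>N\<close>, merely turns \<open>q\<^sup>j\<close> into \<open>q\<^bsup>j - N\<^esup>\<close>
  in the dominating series.
\<close>
lemma laurent_series_partial_theta_interchange:
  fixes c :: "nat \<Rightarrow> complex" and N :: nat
  assumes c: "summable (\<lambda>k. norm (c k))"
    and \<phi>: "\<And>n::nat. (\<lambda>k. c k * (Q ^ n) powi (int k - int N)) sums \<phi> n"
  shows "(\<Sum>n. ((- 1) ^ n * Q ^ (n * (n + 1) div 2) * \<phi> n) * (Q powi j) ^ n)
    = (\<Sum>\<^sub>\<infinity>k. c k * partial_theta q (Q powi (j + (int k - int N))))"
proof -
  note Q0 = Q_nonzero
  define t where "t = (\<lambda>n. (- 1) ^ n * Q ^ (n * (n + 1) div 2) * (Q powi (j - int N)) ^ n)"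
  have t_norm: "summable (\<lambda>n. norm (t n))"
    unfolding t_def by (rule summable_partial_theta)
  define F where "F = (\<lambda>n k. t n * (c k * (Q ^ k) ^ n))"
  have F1: "F n k = (- 1) ^ n * Q ^ (n * (n + 1) div 2) * (Q powi j) ^ n * (c k * (Q ^ n) powi (int k - int N))"
    and F2: "F n k = c k * ((- 1) ^ n * Q ^ (n * (n + 1) div 2) * (Q powi (j + (int k - int N))) ^ n)" for n k
  proof -
    have "Q powi (j - int N) * Q ^ k = Q powi (j + (int k - int N))"
      using Q0 power_int_add[of Q "j - int N" "int k"] by (simp add: algebra_simps)
    then have e: "(Q powi (j - int N)) ^ n * (Q ^ k) ^ n = (Q powi (j + (int k - int N))) ^ n"
      by (metis power_mult_distrib)
    also have "\<dots> = (Q powi j) ^ n * (Q ^ n) powi (int k - int N)"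
      using Q0 by (simp add: power_int_power power_int_power' power_int_add[symmetric] algebra_simps)
    finally show "F n k = (- 1) ^ n * Q ^ (n * (n + 1) div 2) * (Q powi j) ^ n * (c k * (Q ^ n) powi (int k - int N))"
      unfolding F_def t_def by (simp add: mult_ac)
    show "F n k = c k * ((- 1) ^ n * Q ^ (n * (n + 1) div 2) * (Q powi (j + (int k - int N))) ^ n)"
      unfolding F_def t_def using e by (simp add: mult_ac)
  qed
  have "(\<lambda>p. t (fst p) * c (snd p)) summable_on UNIV \<times> UNIV"
    by (intro summable_on_mult_Times norm_summable_imp_summable_on t_norm c)
  then have "(\<lambda>p. norm (t (fst p) * c (snd p))) summable_on UNIV \<times> UNIV"
    by (simp add: summable_on_iff_abs_summable_on_complex)
  then have "(\<lambda>p. norm (F (fst p) (snd p))) summable_on UNIV \<times> UNIV"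
  proof (rule Infinite_Sum.abs_summable_on_comparison_test)
    fix p :: "nat \<times> nat"
    have "norm (c (snd p)) * (q ^ snd p) ^ fst p \<le> norm (c (snd p)) * 1"
      using q_pos q_less_1 by (intro mult_left_mono power_le_one) auto
    then show "norm (F (fst p) (snd p)) \<le> norm (t (fst p) * c (snd p))"
      unfolding F_def norm_mult norm_power using q_pos by (intro mult_left_mono) auto
  qed
  then have "(\<lambda>p. F (fst p) (snd p)) summable_on UNIV \<times> UNIV"
    by (rule abs_summable_summable)
  then have FS: "(\<lambda>(n, k). F n k) summable_on UNIV \<times> UNIV"
    by (simp only: case_prod_unfold)
  have row: "F n summable_on UNIV" for n
    by (rule summable_on_SigmaD1[OF FS]) simp
  have col: "(\<lambda>n. F n k) summable_on UNIV" for k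
  proof -
    have "(\<lambda>(k, n). F n k) summable_on UNIV \<times> UNIV"
      using FS by (subst (asm) summable_on_swap) (simp add: case_prod_unfold)
    then show ?thesis by (rule summable_on_SigmaD1) simp
  qed
  have rowsum: "infsum (F n) UNIV = ((- 1) ^ n * Q ^ (n * (n + 1) div 2) * \<phi> n) * (Q powi j) ^ n" for n
  proof -
    have "F n sums ((- 1) ^ n * Q ^ (n * (n + 1) div 2) * (Q powi j) ^ n * \<phi> n)"
      unfolding F1 by (intro sums_mult \<phi>)
    then show ?thesis
      using infsum_nat_eq_suminf[OF row[of n]] by (simp add: sums_iff mult_ac)
  qed
  have colsum: "infsum (\<lambda>n. F n k) UNIV = c k * partial_theta q (Q powi (j + (int k - int N)))" for k
  proof -
    have "summable (\<lambda>n. (- 1) ^ n * Q ^ (n * (n + 1) div 2) * (Q powi (j + (int k - int N))) ^ n)"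
      using summable_partial_theta by (rule summable_norm_cancel)
    then show ?thesis
      unfolding infsum_nat_eq_suminf[OF col] unfolding F2 partial_theta_def by (rule suminf_mult)
  qed
  have "(\<lambda>n. infsum (F n) UNIV) summable_on UNIV"
    using summable_on_Sigma_banach[OF FS] by simp
  then have "(\<Sum>n. infsum (F n) UNIV) = (\<Sum>\<^sub>\<infinity>n. infsum (F n) UNIV)"
    by (rule infsum_nat_eq_suminf[symmetric])
  also have "\<dots> = (\<Sum>\<^sub>\<infinity>k. infsum (\<lambda>n. F n k) UNIV)"
    using FS by (rule infsum_swap_banach)
  finally show ?thesis unfolding rowsum colsum .
qed

end

section \<open>Laurent expansion of a periodic function\<close>

lemma periodic_add_int_multiple:
  fixes f :: "complex \<Rightarrow> 'a"
  assumes per: "\<And>z. z \<in> S \<Longrightarrow> f (z + p) = f z"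
    and inv: "\<And>z k. z \<in> S \<Longrightarrow> z + of_int k * p \<in> S" and z: "z \<in> S"
  shows "f (z + of_int k * p) = f z"
proof (induction k rule: int_induct[where k = 0])
  case (step1 k)
  have "f (z + of_int k * p + p) = f (z + of_int k * p)"
    by (intro per inv z)
  with step1 show ?case by (simp add: algebra_simps)
next
  case (step2 k)
  have "f (z + of_int (k - 1) * p + p) = f (z + of_int (k - 1) * p)"
    by (intro per inv z)
  with step2 show ?case by (simp add: algebra_simps)
qed simp

text \<open>
  In the variable \<open>w = q\<^sup>z\<close> the half-plane \<open>Re z > -\<delta>\<close> becomes the punctured disc of radius
  \<open>q\<^bsup>-\<delta>\<^esup>\<close>, and \<open>\<phi>\<close> becomes a holomorphic function \<open>\<psi>\<close> on it, by periodicity. Since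
  \<open>|u| = |ln |w| / ln q|\<close>, the bound on \<open>\<phi>\<close> reads \<open>|\<psi>(w)| \<le> M |w|\<^bsup>r / ln q\<^esup>\<close> near \<open>0\<close>, so
  \<open>w\<^sup>N \<psi>(w)\<close> has a removable singularity for large \<open>N\<close>. Its Taylor series is the expansion.
\<close>
lemma periodic_laurent_expansion:
  fixes q \<delta> r :: real and \<phi> :: "complex \<Rightarrow> complex" and \<phi>\<^sub>1 :: "real \<Rightarrow> real"
  assumes q: "0 < q" "q < 1" and \<delta>: "0 < \<delta>"
    and an: "\<phi> analytic_on half_plane \<delta>"
    and per: "\<And>z. z \<in> half_plane \<delta> \<Longrightarrow> \<phi> (z + 2 * \<i> * of_real pi / of_real (ln q)) = \<phi> z"
    and cont: "continuous_on UNIV \<phi>\<^sub>1"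
    and bound: "\<And>u w. Complex u w \<in> half_plane \<delta> \<Longrightarrow>
      norm (\<phi> (Complex u w)) \<le> exp (r * \<bar>u\<bar>) * \<phi>\<^sub>1 w"
  obtains c :: "nat \<Rightarrow> complex" and N :: nat
  where "\<And>z. - \<delta> < Re z \<Longrightarrow> summable (\<lambda>k. norm (c k * (of_real q powr z) ^ k))"
    and "\<And>z. - \<delta> < Re z \<Longrightarrow> (\<lambda>k. c k * (of_real q powr z) powi (int k - int N)) sums \<phi> z"
proof -
  define L where "L = ln q"
  have L: "L < 0" using q by (simp add: L_def)
  define R where "R = exp (- \<delta> * L)"
  have R1: "R > 1" using \<delta> L by (simp add: R_def mult_pos_neg)
  define \<psi> where "\<psi> = (\<lambda>w. \<phi> (Ln w / of_real L))"
  have Re_quot: "Re (t / of_real L) = ln (norm w) / L" if "exp t = w" for t w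
    using that by (auto simp: Re_divide_of_real)
  have right: "- \<delta> < ln (norm w) / L" if "w \<noteq> 0" "norm w < R" for w :: complex
  proof -
    have "ln (norm w) < - \<delta> * L"
      using that by (metis R_def ln_exp ln_less_cancel_iff exp_gt_zero zero_less_norm_iff)
    then show ?thesis using L by (simp add: divide_simps mult.commute)
  qed
  \<comment> \<open>Any logarithm of \<open>w\<close> may be used to evaluate \<open>\<psi> w\<close>.\<close>
  have branch: "\<psi> w = \<phi> (t / of_real L)" if t: "exp t = w" and w: "norm w < R" for t w
  proof -
    have w0: "w \<noteq> 0" using t by auto
    have "exp t = exp (Ln w)" using t w0 by simp
    then obtain n :: int where n: "t = Ln w + of_int (2 * n) * (of_real pi * \<i>)"
      by (metis exp_eq mult.assoc of_int_mult of_real_mult of_real_of_int_eq)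
    have "Ln w / of_real L \<in> half_plane \<delta>"
      using Re_quot[of "Ln w" w] right[OF w0 w] w0 unfolding half_plane_def by simp
    then have "\<phi> (Ln w / of_real L + of_int n * (2 * \<i> * of_real pi / of_real L))
        = \<phi> (Ln w / of_real L)"
    proof (rule periodic_add_int_multiple[rotated 2])
      show "\<phi> (z + 2 * \<i> * of_real pi / of_real L) = \<phi> z" if "z \<in> half_plane \<delta>" for z
        using per[OF that] by (simp add: L_def)
      show "z + of_int k * (2 * \<i> * of_real pi / of_real L) \<in> half_plane \<delta>"
        if "z \<in> half_plane \<delta>" for z k
        using that by (simp add: half_plane_def Re_divide_of_real)
    qed
    moreover have "t / of_real L = Ln w / of_real L + of_int n * (2 * \<i> * of_real pi / of_real L)"
      using L unfolding n by (simp add: field_simps)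
    ultimately show ?thesis by (simp add: \<psi>_def)
  qed
  have hol: "\<psi> holomorphic_on ball 0 R - {0}"
  proof -
    have "\<psi> field_differentiable at w0" if w0: "w0 \<in> ball 0 R - {0}" for w0
    proof -
      \<comment> \<open>A branch of the logarithm that is holomorphic at \<open>w0\<close>, even on the cut of \<open>Ln\<close>.\<close>
      define l where "l = (\<lambda>w. (Ln (w / w0) + Ln w0) / of_real L)"
      have "(Ln \<circ> (\<lambda>w. w / w0)) field_differentiable at w0"
        using w0 by (intro field_differentiable_compose field_differentiable_at_Ln derivative_intros) auto
      then have "l field_differentiable at w0"
        unfolding l_def o_def using L by (intro derivative_intros) auto
      moreover have "\<phi> field_differentiable at (l w0)"
      proof -
        have "l w0 \<in> half_plane \<delta>"
          using w0 Re_quot[of "Ln w0" w0] right[of w0] unfolding l_def half_plane_def by simp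
        then have "\<phi> analytic_on {l w0}" using an analytic_on_subset by blast
        then show ?thesis by (rule analytic_on_imp_differentiable_at) simp
      qed
      ultimately have "(\<phi> \<circ> l) field_differentiable at w0"
        by (rule field_differentiable_compose)
      then obtain D where "((\<phi> \<circ> l) has_field_derivative D) (at w0)"
        by (auto simp: field_differentiable_def)
      then have "(\<psi> has_field_derivative D) (at w0)"
      proof (rule has_field_derivative_transform_within_open[where S = "ball 0 R - {0}"])
        fix w :: complex assume w: "w \<in> ball 0 R - {0}"
        have "exp (Ln (w / w0) + Ln w0) = w"
          using w w0 by (simp add: exp_add)
        with w show "(\<phi> \<circ> l) w = \<psi> w"
          using branch[of "Ln (w / w0) + Ln w0" w] by (simp add: l_def)
      qed (use w0 in auto)
      then show ?thesis by (auto simp: field_differentiable_def)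
    qed
    then show ?thesis
      by (auto simp: holomorphic_on_def intro: field_differentiable_at_within)
  qed
  obtain N :: nat where N: "r / (- L) \<le> real N" using real_arch_simple by blast
  have NL: "real N * L \<le> - r" using N L by (simp add: divide_simps mult.commute split: if_splits)
  \<comment> \<open>The principal logarithm keeps the imaginary part of \<open>Ln w / L\<close> in this interval.\<close>
  have "bounded (\<phi>\<^sub>1 ` {pi / L .. - pi / L})"
    by (intro compact_imp_bounded compact_continuous_image continuous_on_subset[OF cont]) auto
  then obtain M where "\<And>x. x \<in> \<phi>\<^sub>1 ` {pi / L .. - pi / L} \<Longrightarrow> norm x \<le> M"
    unfolding bounded_iff by blast
  then have M: "\<phi>\<^sub>1 y \<le> M" if "y \<in> {pi / L .. - pi / L}" for y
    using that by fastforce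
  have bd: "norm (w ^ N * \<psi> w) \<le> M" if w: "w \<noteq> 0" "norm w < 1" for w
  proof -
    define u where "u = ln (norm w) / L"
    define v where "v = Im (Ln w) / L"
    have u: "u > 0" "ln (norm w) = L * u" using w L by (auto simp: u_def divide_neg_neg)
    have e: "Ln w / of_real L = Complex u v"
      using w by (simp add: complex_eq_iff u_def v_def Re_divide_of_real Im_divide_of_real)
    have "v \<in> {pi / L .. - pi / L}"
    proof -
      have "- pi \<le> Im (Ln w)" "Im (Ln w) \<le> pi" using w mpi_less_Im_Ln[of w] Im_Ln_le_pi[of w] by auto
      then show ?thesis using L
        by (auto simp: v_def divide_right_mono_neg intro: divide_right_mono_neg[of "- pi" _ L, simplified])
    qed
    then have v: "\<phi>\<^sub>1 v \<le> M" by (rule M)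
    have "norm (\<psi> w) \<le> exp (r * u) * \<phi>\<^sub>1 v"
      using bound[of u v] u \<delta> unfolding \<psi>_def e by (simp add: half_plane_def)
    also have "\<dots> \<le> exp (r * u) * M" using v by simp
    finally have 1: "norm (\<psi> w) \<le> exp (r * u) * M" .
    then have M0: "M \<ge> 0" by (metis exp_gt_zero norm_ge_zero order_trans zero_le_mult_iff not_less)
    have "norm w = exp (L * u)" using u(2) w by (metis exp_ln zero_less_norm_iff)
    then have "norm w ^ N = exp (real N * L * u)" by (simp add: exp_of_nat_mult mult.assoc)
    then have "norm (w ^ N * \<psi> w) \<le> exp (real N * L * u) * (exp (r * u) * M)"
      using 1 by (simp add: norm_mult norm_power)
    also have "\<dots> = exp ((real N * L + r) * u) * M"
      by (simp add: exp_add[symmetric] algebra_simps)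
    also have "\<dots> \<le> 1 * M"
      using NL u(1) M0 by (intro mult_right_mono) (auto simp: mult_le_0_iff)
    finally show ?thesis by simp
  qed
  have "(\<lambda>w. w ^ N * \<psi> w) holomorphic_on ball 0 R - {0}"
    by (intro holomorphic_intros hol)
  moreover have "0 \<in> interior (ball 0 R :: complex set)" using R1 by simp
  moreover have "eventually (\<lambda>w. norm (w ^ N * \<psi> w) \<le> M) (at 0)"
    unfolding eventually_at by (rule exI[of _ 1]) (auto intro!: bd)
  ultimately obtain g where g: "g holomorphic_on ball 0 R"
    and g_eq: "\<And>w. w \<in> ball 0 R - {0} \<Longrightarrow> g w = w ^ N * \<psi> w"
    using holomorphic_on_extend_bounded[of "\<lambda>w. w ^ N * \<psi> w" "ball 0 R" 0] by blast
  define c where "c = (\<lambda>k. (deriv ^^ k) g 0 / fact k)"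
  have c: "(\<lambda>k. c k * w ^ k) sums g w" if "w \<in> ball 0 R" for w
    using holomorphic_power_series[OF g that] by (simp add: c_def)
  have w: "of_real q powr z \<noteq> 0" "of_real q powr z = exp (z * of_real L)"
    "norm (of_real q powr z) < R" if "- \<delta> < Re z" for z
  proof -
    show 1: "of_real q powr z = exp (z * of_real L)" 
      using q by (simp add: powr_def L_def Ln_of_real)
    show "of_real q powr z \<noteq> 0" using q by simp
    show "norm (of_real q powr z) < R"
      unfolding 1 R_def using mult_strict_right_mono_neg[OF that L] by simp
  qed
  show ?thesis
  proof
    fix z assume z: "- \<delta> < Re z"
    let ?w = "of_real q powr z"
    \<comment> \<open>Absolute convergence at \<open>?w\<close> follows from convergence at a point of larger modulus.\<close>
    obtain R' where R': "norm ?w < R'" "R' < R" using w(3)[OF z] dense by blast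
    have "summable (\<lambda>k. c k * of_real R' ^ k)"
      using c[of "of_real R'"] R' norm_ge_zero[of ?w] by (auto simp: sums_iff simp del: norm_ge_zero)
    then show "summable (\<lambda>k. norm (c k * ?w ^ k))"
      by (rule powser_insidea) (use R' in auto)
    have "(\<lambda>k. c k * ?w ^ k / ?w ^ N) sums (g ?w / ?w ^ N)"
      using w[OF z] by (intro sums_divide c) auto
    moreover have "g ?w / ?w ^ N = \<phi> z"
      using g_eq[of ?w] w[OF z] branch[of "z * of_real L" ?w] L by simp
    moreover have "c k * ?w ^ k / ?w ^ N = c k * ?w powi (int k - int N)" for k
      using w(1)[OF z] by (simp add: power_int_diff)
    ultimately show "(\<lambda>k. c k * ?w powi (int k - int N)) sums \<phi> z" by simp
  qed
qed

section \<open>The Jackson integral\<close>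

lemma q_Gamma_reflection:
  assumes "0 < q" "q < 1"
  shows "q_Gamma q s * q_Gamma q (1 - s) = of_real (1 - q) *
    (qpochhammer_inf (of_real q) q ^ 2 /
      (qpochhammer_inf (of_real q powr s) q * qpochhammer_inf (of_real q / of_real q powr s) q))"
proof -
  have "of_real (1 - q) powr (1 - s) * of_real (1 - q) powr s = (of_real (1 - q) :: complex)"
    using assms by (simp add: powr_add[symmetric] del: of_real_diff)
  moreover have "of_real q powr (1 - s) = of_real q / (of_real q powr s :: complex)"
    using assms by (simp add: powr_diff)
  ultimately show ?thesis
    unfolding q_Gamma_def by (simp add: power2_eq_square mult_ac flip: times_divide_eq_right)
qed

theorem theorem6:
  fixes q \<delta> r :: real and \<phi> :: "complex \<Rightarrow> complex" and \<phi>\<^sub>1 :: "real \<Rightarrow> real" and s :: complex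
  assumes "0 < q" and "q < 1"
    and "0 < \<delta>" and "\<delta> < 1"
    and "\<phi> analytic_on half_plane \<delta>"
    and "\<And>z. z \<in> half_plane \<delta> \<Longrightarrow> \<phi> (z + 2 * \<i> * of_real pi / of_real (ln q)) = \<phi> z"
    and "continuous_on UNIV \<phi>\<^sub>1"
    and "\<And>u w. Complex u w \<in> half_plane \<delta> \<Longrightarrow> norm (\<phi> (Complex u w)) \<le> exp (r * \<bar>u\<bar>) * \<phi>\<^sub>1 w"
    and "0 < Re s" and "Re s < \<delta>"
  defines "a \<equiv> (\<lambda>n::nat. (- 1) ^ n * of_real q ^ (n * (n + 1) div 2) * \<phi> (of_nat n))"
  shows "(\<forall>x::real. x > 0 \<longrightarrow> summable (\<lambda>n. a n * of_real x ^ n)) \<and>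
    jackson_integrable q (\<lambda>x. of_real x powr (s - 1) * (\<Sum>n. a n * of_real x ^ n)) \<and>
    jackson_integral q (\<lambda>x. of_real x powr (s - 1) * (\<Sum>n. a n * of_real x ^ n)) =
      q_Gamma q s * q_Gamma q (1 - s) * \<phi> (- s)"
proof -
  let ?Q = "complex_of_real q"
  note q = assms(1,2)
  have conv: "summable (\<lambda>n. a n * of_real x ^ n)" if x: "x > 0" for x :: real
  proof (rule summable_comparison_test')
    have "summable (\<lambda>n. q ^ (n * (n + 1) div 2) * (exp r * x) ^ n)"
      using q x by (intro summable_qsquare_power) auto
    then show "summable (\<lambda>n. \<phi>\<^sub>1 0 * (q ^ (n * (n + 1) div 2) * (exp r * x) ^ n))"
      by (rule summable_mult)
    fix n :: nat
    have "norm (\<phi> (of_nat n)) \<le> exp (r * real n) * \<phi>\<^sub>1 0"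
      using assms(8)[of "real n" 0] assms(3) by (simp add: half_plane_def complex_of_real_def[symmetric])
    also have "exp (r * real n) = exp r ^ n"
      by (metis exp_of_nat_mult mult.commute)
    finally have "q ^ (n * (n + 1) div 2) * x ^ n * norm (\<phi> (of_nat n))
        \<le> q ^ (n * (n + 1) div 2) * x ^ n * (exp r ^ n * \<phi>\<^sub>1 0)"
      using q x by (intro mult_left_mono) auto
    then show "norm (a n * of_real x ^ n) \<le> \<phi>\<^sub>1 0 * (q ^ (n * (n + 1) div 2) * (exp r * x) ^ n)"
      using q x by (simp add: a_def norm_mult norm_power power_mult_distrib mult_ac)
  qed
  obtain c N where c_abs: "\<And>z. - \<delta> < Re z \<Longrightarrow> summable (\<lambda>k. norm (c k * (?Q powr z) ^ k))"
    and c_sums: "\<And>z. - \<delta> < Re z \<Longrightarrow> (\<lambda>k. c k * (?Q powr z) powi (int k - int N)) sums \<phi> z"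
    using periodic_laurent_expansion[OF assms(1-3,5-8)] by metis
  define z where "z = ?Q powr s"
  have z0: "z \<noteq> 0" using q by (simp add: z_def)
  have norm_z: "norm z = q powr Re s" using q by (simp add: z_def norm_powr_real_powr)
  have "q powr 1 < q powr Re s" "q powr Re s < q powr 0"
    using q assms(4,9,10) by (intro powr_less_mono'; simp)+
  then have z: "q < norm z" "norm z < 1" using q by (simp_all add: norm_z)
  define F where "F = (\<lambda>x::real. \<Sum>n. a n * of_real x ^ n)"
  have F: "F (q powi j) = (\<Sum>\<^sub>\<infinity>k. c k * partial_theta q (?Q powi (j + (int k - int N))))" for j
  proof -
    have "summable (\<lambda>k. norm (c k))" using c_abs[of 0] assms(3) q by simp
    moreover have "(\<lambda>k. c k * (?Q ^ n) powi (int k - int N)) sums \<phi> (of_nat n)" for n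
      using c_sums[of "of_nat n"] assms(3) q by (simp add: powr_nat)
    ultimately show ?thesis
      unfolding F_def a_def of_real_power_int by (rule laurent_series_partial_theta_interchange[OF q])
  qed
  \<comment> \<open>The \<open>j\<close>-th term of the Jackson integral is \<open>z\<^sup>j F(q\<^sup>j) = \<Sum>\<^sub>k f(j + (k - N)) g(k)\<close>: multiplying
    \<open>c\<^sub>k\<close> by \<open>z\<^bsup>N - k\<^esup>\<close> compensates the shift of the exponent of \<open>z\<close> in \<open>f\<close>, and
    these factors sum to \<open>\<phi>(-s)\<close>.\<close>
  define f where "f = (\<lambda>j. z powi j * partial_theta q (?Q powi j))"
  define g where "g = (\<lambda>k. c k * z powi (int N - int k))"
  have inv_z: "?Q powr (- s) = inverse z" by (simp add: z_def powr_minus)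
  have g_eq: "g k = c k * (?Q powr (- s)) powi (int k - int N)" for k
    unfolding g_def inv_z using power_int_minus[of z "int k - int N"] by (simp add: power_int_inverse)
  have g_abs: "summable (\<lambda>k. norm (g k))"
  proof -
    have "summable (\<lambda>k. norm (z ^ N) * norm (c k * (?Q powr (- s)) ^ k))"
      using c_abs[of "- s"] assms(10) by (intro summable_mult) auto
    moreover have "norm (z ^ N) * norm (c k * (?Q powr (- s)) ^ k) = norm (g k)" for k
      unfolding g_def inv_z norm_mult[symmetric] using z0
      by (simp add: power_int_diff power_inverse field_simps)
    ultimately show ?thesis by simp
  qed
  have g: "(g has_sum \<phi> (- s)) UNIV"
  proof (rule norm_summable_imp_has_sum[OF g_abs])
    show "g sums \<phi> (- s)"
      unfolding g_eq[abs_def] by (rule c_sums) (use assms(10) in simp)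
  qed
  note f = partial_theta_bilateral_sum[OF q z, folded f_def]
  note shear = has_sum_mult_shear[of f g, where \<sigma> = "\<lambda>k. int k - int N"]
  have row: "(\<Sum>\<^sub>\<infinity>k. f (j + (int k - int N)) * g k) = z powi j * F (q powi j)" for j
  proof -
    have "f (j + (int k - int N)) * g k
        = z powi j * (c k * partial_theta q (?Q powi (j + (int k - int N))))" for k
    proof -
      have "z powi (j + (int k - int N)) * z powi (int N - int k) = z powi j"
        using z0 by (simp add: power_int_add[symmetric])
      then show ?thesis by (simp add: f_def g_def mult_ac)
    qed
    then show ?thesis unfolding F by (simp add: infsum_cmult_right')
  qed
  have summand: "of_real (q powi j) powr (s - 1) * F (q powi j) * of_real (q powi j)
      = z powi j * F (q powi j)" for j
  proof -
    have e: "q powi j = exp (real_of_int j * ln q)"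
      using q by (simp add: powr_real_of_int'[symmetric] powr_def)
    have "complex_of_real (q powi j) powr (s - 1) * of_real (q powi j) = of_real (q powi j) powr s"
      using q by (simp add: powr_diff)
    also have "\<dots> = z powi j"
      using q by (simp add: z_def e powr_def Ln_of_real exp_power_int mult_ac)
    finally show ?thesis by (simp add: mult_ac)
  qed
  have sum: "((\<lambda>j. of_real (q powi j) powr (s - 1) * F (q powi j) * of_real (q powi j))
      has_sum (qpochhammer_inf ?Q q ^ 2 / (qpochhammer_inf z q * qpochhammer_inf (?Q / z) q)
        * \<phi> (- s))) UNIV"
    unfolding summand using shear(1)[unfolded row] f g
    by (auto simp only: summable_on_def infsumI)
  show ?thesis
  proof (intro conjI allI impI)
    show "jackson_integrable q (\<lambda>x. of_real x powr (s - 1) * (\<Sum>n. a n * of_real x ^ n))"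
      unfolding jackson_integrable_def using sum by (auto simp: summable_on_def F_def)
    show "jackson_integral q (\<lambda>x. of_real x powr (s - 1) * (\<Sum>n. a n * of_real x ^ n)) =
        q_Gamma q s * q_Gamma q (1 - s) * \<phi> (- s)"
      unfolding jackson_integral_def q_Gamma_reflection[OF q] z_def[symmetric]
      using infsumI[OF sum] by (simp add: F_def mult.assoc)
  qed (rule conv)
qed

end
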